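(* Let $f:S\to T$ be a map in $2\mathrm{PreNet}$ and $g:T'\to T$ a weak equivalence. Then there exist a prenet $S'$ and maps $f':S'\to T'$, $g':S'\to S$ in $2\mathrm{PreNet}$ such that $g f'=f g'$ and $g'$ is also a weak equivalence.
   Context: **2-prenets.** For a totally ordered finite set $S$, an interval is a subset $J\subset S$ such that $x<y<z$ with $x,z\in J$ implies $y\in J$; $\mathrm{Int}(S)$ is the set of nonempty intervals. For subsets, $U<V$ means $u<v$ for all $u\in U,v\in V$. A 2-prenet consists of totally ordered finite sets $S_0,S_1,S_2$ and parent maps $p_i:S_i\to\mathrm{Int}(S_{i-1})$, $i=1,2$ (written $p$ or $p_S$). Put $p^{-1}(t)=\{x: t\in p(x)\}$ (children of $t$), and let $<^\circ$ be the partial order on $S_i$ ($i\ge1$) generated by the relations $x<^\circ y$ for $x<y$ having a common parent. It is required that whenever $x<y$ in $S_i$ are incomparable for $<^\circ$, then $p(x)<p(y)$. For $U\subset S_i$, $p(U)=\bigcup_{x\in U}p(x)$. It is connected if $|S_0|=1$, and pruned if $p^{-1}(t)\neq\emptyset$ for all $t\in S_i$, $i<2$. A 2-prenet with tassels has in addition a subset $t(S)\subset S_2$ (tassels); $c(S_2)=S_2\setminus t(S)$ is the set of core vertices. **Maps.** For $U\subset S_i$, $A(U)$ (resp. $B(U)$) is the set of minimal (resp. maximal) elements of the sets $p^{-1}(z)\cap U$, $z\in p(U)$. A subset $V\subset S_i$ is a disjoint cover of $W\subset S_{i-1}$ if the sets $p(x)$, $x\in V$, are pairwise disjoint with union $W$.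 A map $f:S\to T$ is a collection $f_i:S_i\to T_i$ such that (a) $x<^\circ y$ implies $f(x)<^\circ f(y)$ or $f(x)=f(y)$; (b) $f^{-1}(p_T(x))=p_S(f^{-1}(x))$ for all $x\in T_i$, $i\ge1$; (c) $A(f^{-1}(x))$ and $B(f^{-1}(x))$ are disjoint covers of this set; (d) $f(c(S_2))\subset c(T_2)$. $2\mathrm{PreNet}$ is the category of connected pruned 2-prenets with tassels; "prenet" means an object of it. **Weak equivalences.** A map $f:S\to T$ in $2\mathrm{PreNet}$ is a weak equivalence if $f_2$ restricts to a bijection $c(S_2)\to c(T_2)$ and $p_S(x)=f^{-1}p_Tf(x)$ for all $x\in S_2$. *)

theory Defs
  imports Main "HOL-Library.Disjoint_Sets"
begin

text \<open>
  The three finite totally ordered sets of a 2-prenet are the levels \<open>verts S i\<close>, \<open>i \<le> 2\<close>, with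
  reflexive linear orders \<open>vle S i\<close>; \<open>parents S i\<close> is the parent map from level \<open>i\<close> to subsets of
  level \<open>i - 1\<close> for \<open>i = 1, 2\<close>. Values at other indices, or outside the levels, are irrelevant.
\<close>

record 'a prenet_data =
  verts :: "nat \<Rightarrow> 'a set"
  vle :: "nat \<Rightarrow> 'a rel"
  parents :: "nat \<Rightarrow> 'a \<Rightarrow> 'a set"
  tassels :: "'a set"

definition core :: "'a prenet_data \<Rightarrow> 'a set" where
  "core S = verts S 2 - tassels S"

definition vless :: "'a prenet_data \<Rightarrow> nat \<Rightarrow> 'a \<Rightarrow> 'a \<Rightarrow> bool" where
  "vless S i x y \<longleftrightarrow> (x, y) \<in> vle S i \<and> x \<noteq> y"

definition set_less :: "'a prenet_data \<Rightarrow> nat \<Rightarrow> 'a set \<Rightarrow> 'a set \<Rightarrow> bool" where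
  "set_less S i U V \<longleftrightarrow> (\<forall>u\<in>U. \<forall>v\<in>V. vless S i u v)"

definition intervals :: "'a prenet_data \<Rightarrow> nat \<Rightarrow> 'a set set" where
  "intervals S i = {J. J \<subseteq> verts S i \<and> J \<noteq> {} \<and>
     (\<forall>x\<in>J. \<forall>z\<in>J. \<forall>y\<in>verts S i. vless S i x y \<and> vless S i y z \<longrightarrow> y \<in> J)}"

text \<open>Here \<open>i\<close> is the level of the children, so that \<open>t\<close> lives at level \<open>i - 1\<close>.\<close>

definition children :: "'a prenet_data \<Rightarrow> nat \<Rightarrow> 'a \<Rightarrow> 'a set" where
  "children S i t = {x \<in> verts S i. t \<in> parents S i x}"

definition parents_of_set :: "'a prenet_data \<Rightarrow> nat \<Rightarrow> 'a set \<Rightarrow> 'a set" where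
  "parents_of_set S i U = (\<Union>x\<in>U. parents S i x)"

text \<open>
  The strict partial order \<open><\<^sup>\<circ>\<close>. The generating relation is contained in the strict total order of
  the level, so its transitive closure is irreflexive.
\<close>

definition circ_less :: "'a prenet_data \<Rightarrow> nat \<Rightarrow> 'a rel" where
  "circ_less S i =
     {(x, y). x \<in> verts S i \<and> y \<in> verts S i \<and> vless S i x y
            \<and> parents S i x \<inter> parents S i y \<noteq> {}}\<^sup>+"

definition two_prenet :: "'a prenet_data \<Rightarrow> bool" where
  "two_prenet S \<longleftrightarrow>
     (\<forall>i\<in>{0, 1, 2}. finite (verts S i) \<and> linear_order_on (verts S i) (vle S i)) \<and>
     (\<forall>i\<in>{1, 2}. \<forall>x\<in>verts S i. parents S i x \<in> intervals S (i - 1)) \<and>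
     (\<forall>i\<in>{1, 2}. \<forall>x\<in>verts S i. \<forall>y\<in>verts S i.
        vless S i x y \<and> (x, y) \<notin> circ_less S i \<and> (y, x) \<notin> circ_less S i
        \<longrightarrow> set_less S (i - 1) (parents S i x) (parents S i y))"

definition two_prenet_with_tassels :: "'a prenet_data \<Rightarrow> bool" where
  "two_prenet_with_tassels S \<longleftrightarrow> two_prenet S \<and> tassels S \<subseteq> verts S 2"

definition connected_prenet :: "'a prenet_data \<Rightarrow> bool" where
  "connected_prenet S \<longleftrightarrow> card (verts S 0) = 1"

definition pruned :: "'a prenet_data \<Rightarrow> bool" where
  "pruned S \<longleftrightarrow> (\<forall>i\<in>{0, 1}. \<forall>t\<in>verts S i. children S (i + 1) t \<noteq> {})"

definition prenet :: "'a prenet_data \<Rightarrow> bool" where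
  "prenet S \<longleftrightarrow> two_prenet_with_tassels S \<and> connected_prenet S \<and> pruned S"

text \<open>
  \<open>A(U)\<close> and \<open>B(U)\<close>. On the children of a fixed vertex the total order and \<open><\<^sup>\<circ>\<close> agree, so
  minimality and maximality are unambiguous.
\<close>

definition minimal_children :: "'a prenet_data \<Rightarrow> nat \<Rightarrow> 'a set \<Rightarrow> 'a set" where
  "minimal_children S i U = {m. \<exists>z\<in>parents_of_set S i U. m \<in> children S i z \<inter> U \<and>
     \<not> (\<exists>y \<in> children S i z \<inter> U. vless S i y m)}"

definition maximal_children :: "'a prenet_data \<Rightarrow> nat \<Rightarrow> 'a set \<Rightarrow> 'a set" where
  "maximal_children S i U = {m. \<exists>z\<in>parents_of_set S i U. m \<in> children S i z \<inter> U \<and>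
     \<not> (\<exists>y \<in> children S i z \<inter> U. vless S i m y)}"

definition disjoint_cover :: "'a prenet_data \<Rightarrow> nat \<Rightarrow> 'a set \<Rightarrow> 'a set \<Rightarrow> bool" where
  "disjoint_cover S i V W \<longleftrightarrow> V \<subseteq> verts S i \<and> W \<subseteq> verts S (i - 1) \<and>
     disjoint_family_on (parents S i) V \<and> (\<Union>x\<in>V. parents S i x) = W"

definition preimage :: "'a prenet_data \<Rightarrow> (nat \<Rightarrow> 'a \<Rightarrow> 'b) \<Rightarrow> nat \<Rightarrow> 'b set \<Rightarrow> 'a set" where
  "preimage S f i W = {x \<in> verts S i. f i x \<in> W}"

definition prenet_map ::
    "'a prenet_data \<Rightarrow> 'b prenet_data \<Rightarrow> (nat \<Rightarrow> 'a \<Rightarrow> 'b) \<Rightarrow> bool" where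
  "prenet_map S T f \<longleftrightarrow>
     (\<forall>i\<in>{0, 1, 2}. f i ` verts S i \<subseteq> verts T i) \<and>
     (\<forall>i\<in>{1, 2}. \<forall>x\<in>verts S i. \<forall>y\<in>verts S i.
        (x, y) \<in> circ_less S i \<longrightarrow> (f i x, f i y) \<in> circ_less T i \<or> f i x = f i y) \<and>
     (\<forall>i\<in>{1, 2}. \<forall>x\<in>verts T i.
        preimage S f (i - 1) (parents T i x) = parents_of_set S i (preimage S f i {x})) \<and>
     (\<forall>i\<in>{1, 2}. \<forall>x\<in>verts T i.
        disjoint_cover S i (minimal_children S i (preimage S f i {x}))
          (preimage S f (i - 1) (parents T i x)) \<and>
        disjoint_cover S i (maximal_children S i (preimage S f i {x}))
          (preimage S f (i - 1) (parents T i x))) \<and>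
     f 2 ` core S \<subseteq> core T"

definition weak_equivalence ::
    "'a prenet_data \<Rightarrow> 'b prenet_data \<Rightarrow> (nat \<Rightarrow> 'a \<Rightarrow> 'b) \<Rightarrow> bool" where
  "weak_equivalence S T f \<longleftrightarrow>
     prenet_map S T f \<and> bij_betw (f 2) (core S) (core T) \<and>
     (\<forall>x\<in>verts S 2. parents S 2 x = preimage S f 1 (parents T 2 (f 2 x)))"

end

theory Submission
  imports Defs
begin

text \<open>
  For \<open>y \<in> T\<^sub>i\<close> all elements of the fibre \<open>g\<^sup>-\<^sup>1(y)\<close> have the same parents, so this fibre is a chain
  \<open>x\<^sub>1 < \<dots> < x\<^sub>k\<close>. On the full product with the fibre \<open>U = f\<^sup>-\<^sup>1(y)\<close> there is in general no order for
  which both projections respect \<open><\<^sup>\<circ>\<close>. One picks an index \<open>j\<close> and keeps only the staircase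
  \<open>A(U) \<times> {x\<^sub>1, \<dots>, x\<^sub>j\<^sub>-\<^sub>1} \<union> U \<times> {x\<^sub>j} \<union> B(U) \<times> {x\<^sub>j\<^sub>+\<^sub>1, \<dots>, x\<^sub>k}\<close>, ordered lexicographically, with
  parents pulled back from \<open>S\<close>. Since \<open>A(U)\<close> and \<open>B(U)\<close> are disjoint covers, an element of \<open>A(U)\<close>
  is minimal in \<open>U\<close> below each of its parents, and dually for \<open>B(U)\<close>; hence the projection to
  \<open>T'\<close> respects \<open><\<^sup>\<circ>\<close>. If \<open>y\<close> is a core vertex, \<open>x\<^sub>j\<close> is taken to be the core vertex above \<open>y\<close>, so that
  every core vertex of \<open>S\<close> lifts to a core vertex.
\<close>

section \<open>Prenets\<close>

context
  fixes S :: "'a prenet_data" and i :: nat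
  assumes two: "two_prenet S" and i: "i \<in> {0, 1, 2}"
begin

lemma finite_verts: "finite (verts S i)"
  using two i unfolding two_prenet_def by blast

lemma linear_order_vle: "linear_order_on (verts S i) (vle S i)"
  using two i unfolding two_prenet_def by blast

lemma vle_refl: "x \<in> verts S i \<Longrightarrow> (x, x) \<in> vle S i"
  using linear_order_vle
  by (auto simp: order_on_defs refl_on_def)

lemma vle_trans: "(x, y) \<in> vle S i \<Longrightarrow> (y, z) \<in> vle S i \<Longrightarrow> (x, z) \<in> vle S i"
  using linear_order_vle unfolding order_on_defs by (meson transD)

lemma vle_antisym: "(x, y) \<in> vle S i \<Longrightarrow> (y, x) \<in> vle S i \<Longrightarrow> x = y"
  using linear_order_vle unfolding order_on_defs by (meson antisymD)

lemma vless_total: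
  "x \<in> verts S i \<Longrightarrow> y \<in> verts S i \<Longrightarrow> x \<noteq> y \<Longrightarrow> vless S i x y \<or> vless S i y x"
  using linear_order_vle unfolding order_on_defs total_on_def vless_def by blast

lemma vless_trans: "vless S i x y \<Longrightarrow> vless S i y z \<Longrightarrow> vless S i x z"
  using vle_trans vle_antisym unfolding vless_def by blast

lemma vless_asym: "vless S i x y \<Longrightarrow> \<not> vless S i y x"
  using vle_antisym unfolding vless_def by blast

lemma ex_minimal:
  assumes "X \<subseteq> verts S i" "X \<noteq> {}"
  shows "\<exists>m\<in>X. \<not> (\<exists>y\<in>X. vless S i y m)"
proof -
  have "finite X" using assms finite_verts finite_subset by blast
  moreover have "asymp_on X (vless S i)" "transp_on X (vless S i)"
    by (blast intro: transp_onI dest: vless_asym vless_trans)+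
  ultimately have "\<exists>m\<in>X. \<forall>x\<in>X. x \<noteq> m \<longrightarrow> \<not> vless S i x m"
    using assms(2) Finite_Set.bex_min_element by blast
  then show ?thesis by (auto simp: vless_def)
qed

lemma ex_maximal:
  assumes "X \<subseteq> verts S i" "X \<noteq> {}"
  shows "\<exists>m\<in>X. \<not> (\<exists>y\<in>X. vless S i m y)"
proof -
  have "finite X" using assms finite_verts finite_subset by blast
  moreover have "asymp_on X (vless S i)" "transp_on X (vless S i)"
    by (blast intro: transp_onI dest: vless_asym vless_trans)+
  ultimately have "\<exists>m\<in>X. \<forall>x\<in>X. x \<noteq> m \<longrightarrow> \<not> vless S i m x"
    using assms(2) Finite_Set.bex_max_element by blast
  then show ?thesis by (auto simp: vless_def)
qed

text \<open>The first child of \<open>z\<close> in \<open>U\<close> also belongs to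
  \<open>minimal_children S i U\<close> and shares the parent \<open>z\<close> with
  \<open>a\<close>, so disjointness forces it to be \<open>a\<close>. Thus minimality below one
  parent becomes minimality below all of them; this is how the cover condition on \<open>f\<close>
  is used to compare vertices.\<close>

lemma disjoint_minimal_children_least:
  assumes disj: "disjoint_family_on (parents S i) (minimal_children S i U)"
    and U: "U \<subseteq> verts S i" and a: "a \<in> minimal_children S i U" and s: "s \<in> U"
    and z: "z \<in> parents S i a" "z \<in> parents S i s"
  shows "\<not> vless S i s a"
proof -
  have "s \<in> children S i z \<inter> U" using s U z(2) unfolding children_def by blast
  then obtain m where m: "m \<in> children S i z \<inter> U"
      "\<not> (\<exists>y\<in>children S i z \<inter> U. vless S i y m)"
    using ex_minimal[of "children S i z \<inter> U"] U by blast
  have "z \<in> parents S i m" using m(1) unfolding children_def by blast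
  moreover have "z \<in> parents_of_set S i U" using s z(2) unfolding parents_of_set_def by blast
  ultimately have "m = a"
    using disj a z(1) m unfolding disjoint_family_on_def minimal_children_def by blast
  then show ?thesis using m(2) \<open>s \<in> children S i z \<inter> U\<close> by blast
qed

lemma disjoint_maximal_children_greatest:
  assumes disj: "disjoint_family_on (parents S i) (maximal_children S i U)"
    and U: "U \<subseteq> verts S i" and b: "b \<in> maximal_children S i U" and s: "s \<in> U"
    and z: "z \<in> parents S i b" "z \<in> parents S i s"
  shows "\<not> vless S i b s"
proof -
  have "s \<in> children S i z \<inter> U" using s U z(2) unfolding children_def by blast
  then obtain m where m: "m \<in> children S i z \<inter> U"
      "\<not> (\<exists>y\<in>children S i z \<inter> U. vless S i m y)"
    using ex_maximal[of "children S i z \<inter> U"] U by blast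
  have "z \<in> parents S i m" using m(1) unfolding children_def by blast
  moreover have "z \<in> parents_of_set S i U" using s z(2) unfolding parents_of_set_def by blast
  ultimately have "m = b"
    using disj b z(1) m unfolding disjoint_family_on_def maximal_children_def by blast
  then show ?thesis using m(2) \<open>s \<in> children S i z \<inter> U\<close> by blast
qed

text \<open>Each \<open>z\<close> in \<open>W\<close> sees all of \<open>U\<close>, so the extremal
  set is a single vertex, which covers \<open>W\<close> alone. The fibres of \<open>g'\<close> are
  of this kind.\<close>

lemma disjoint_cover_extremal_children_const:
  assumes U: "U \<subseteq> verts S i" "U \<noteq> {}" and par: "\<And>x. x \<in> U \<Longrightarrow> parents S i x = W"
    and W: "W \<subseteq> verts S (i - 1)" "W \<noteq> {}"
  shows "disjoint_cover S i (minimal_children S i U) W"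
    and "disjoint_cover S i (maximal_children S i U) W"
proof -
  have ch: "children S i z \<inter> U = U" if "z \<in> W" for z
    using that U(1) by (auto simp: children_def par)
  have pU: "parents_of_set S i U = W" using U(2) by (auto simp: parents_of_set_def par)
  have mn: "minimal_children S i U = {m \<in> U. \<not> (\<exists>y\<in>U. vless S i y m)}"
    unfolding minimal_children_def pU using ch W(2) by auto
  have mx: "maximal_children S i U = {m \<in> U. \<not> (\<exists>y\<in>U. vless S i m y)}"
    unfolding maximal_children_def pU using ch W(2) by auto
  obtain m where m: "m \<in> U" "\<not> (\<exists>y\<in>U. vless S i y m)" using ex_minimal U by blast
  have "minimal_children S i U = {m}"
    unfolding mn using m U vless_total by blast
  then show "disjoint_cover S i (minimal_children S i U) W"
    using m U W par unfolding disjoint_cover_def disjoint_family_on_def by auto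
  obtain n where n: "n \<in> U" "\<not> (\<exists>y\<in>U. vless S i n y)" using ex_maximal U by blast
  have "maximal_children S i U = {n}"
    unfolding mx using n U vless_total by blast
  then show "disjoint_cover S i (maximal_children S i U) W"
    using n U W par unfolding disjoint_cover_def disjoint_family_on_def by auto
qed

end

lemma minimal_children_iff:
  assumes "U \<subseteq> verts S i"
  shows "m \<in> minimal_children S i U \<longleftrightarrow>
    m \<in> U \<and> (\<exists>z\<in>parents S i m. \<forall>y\<in>U. z \<in> parents S i y \<longrightarrow> \<not> vless S i y m)"
  using assms unfolding minimal_children_def parents_of_set_def children_def by blast

lemma maximal_children_iff:
  assumes "U \<subseteq> verts S i"
  shows "m \<in> maximal_children S i U \<longleftrightarrow>
    m \<in> U \<and> (\<exists>z\<in>parents S i m. \<forall>y\<in>U. z \<in> parents S i y \<longrightarrow> \<not> vless S i m y)"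
  using assms unfolding maximal_children_def parents_of_set_def children_def by blast

text \<open>Without shared parents every vertex is the only child in \<open>U\<close> of each of its
  parents. This handles those fibres of \<open>f'\<close> that are copies of \<open>A(U)\<close> or
  \<open>B(U)\<close>.\<close>

lemma minimal_children_disjoint:
  assumes "disjoint_family_on (parents S i) U" "U \<subseteq> verts S i"
    and "\<And>x. x \<in> U \<Longrightarrow> parents S i x \<noteq> {}"
  shows "minimal_children S i U = U"
proof (rule equalityI; rule subsetI)
  fix x assume x: "x \<in> U"
  then obtain z where z: "z \<in> parents S i x" using assms(3) by blast
  have "children S i z \<inter> U = {x}"
    using assms(1,2) x z unfolding children_def disjoint_family_on_def by blast
  moreover have "z \<in> parents_of_set S i U" using x z unfolding parents_of_set_def by blast
  ultimately show "x \<in> minimal_children S i U"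
    unfolding minimal_children_def vless_def by auto
qed (auto simp: minimal_children_def)

lemma maximal_children_disjoint:
  assumes "disjoint_family_on (parents S i) U" "U \<subseteq> verts S i"
    and "\<And>x. x \<in> U \<Longrightarrow> parents S i x \<noteq> {}"
  shows "maximal_children S i U = U"
proof (rule equalityI; rule subsetI)
  fix x assume x: "x \<in> U"
  then obtain z where z: "z \<in> parents S i x" using assms(3) by blast
  have "children S i z \<inter> U = {x}"
    using assms(1,2) x z unfolding children_def disjoint_family_on_def by blast
  moreover have "z \<in> parents_of_set S i U" using x z unfolding parents_of_set_def by blast
  ultimately show "x \<in> maximal_children S i U"
    unfolding maximal_children_def vless_def by auto
qed (auto simp: maximal_children_def)

section \<open>The order \<open>circ_less\<close>: generators, images and lifts\<close>

lemma circ_lessI: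
  "x \<in> verts S i \<Longrightarrow> y \<in> verts S i \<Longrightarrow> vless S i x y \<Longrightarrow> parents S i x \<inter> parents S i y \<noteq> {}
    \<Longrightarrow> (x, y) \<in> circ_less S i"
  unfolding circ_less_def by (rule r_into_trancl) auto

lemma circ_less_trans:
  "(x, y) \<in> circ_less S i \<Longrightarrow> (y, z) \<in> circ_less S i \<Longrightarrow> (x, z) \<in> circ_less S i"
  unfolding circ_less_def by (rule trancl_trans)

lemma circ_less_vless:
  assumes "two_prenet S" "i \<in> {0, 1, 2}" and "(x, y) \<in> circ_less S i"
  shows "vless S i x y"
  using assms(3) unfolding circ_less_def
  by (induction rule: trancl_induct) (auto dest: vless_trans[OF assms(1,2)])

text \<open>Reduces the order condition on maps to generating pairs: along a chain of generators,
  strict steps compose and equalities are absorbed.\<close>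

lemma circ_less_map:
  assumes "\<And>x y. x \<in> verts S i \<Longrightarrow> y \<in> verts S i \<Longrightarrow> vless S i x y \<Longrightarrow>
      parents S i x \<inter> parents S i y \<noteq> {} \<Longrightarrow> (h x, h y) \<in> circ_less T i \<or> h x = h y"
    and "(x, y) \<in> circ_less S i"
  shows "(h x, h y) \<in> circ_less T i \<or> h x = h y"
  using assms(2) unfolding circ_less_def[of S]
proof (induction rule: trancl_induct)
  case (base y)
  then show ?case using assms(1) by blast
next
  case (step y z)
  then have "(h y, h z) \<in> circ_less T i \<or> h y = h z" using assms(1) by blast
  then show ?case using step.IH circ_less_trans by metis
qed

text \<open>A chain of generators in \<open>T\<close> is lifted step by step: surjectivity supplies
  the intermediate vertices, and \<open>gen\<close> applies to whichever lifts are chosen.\<close>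

lemma circ_less_lift:
  assumes surj: "h ` verts S i = verts T i"
    and gen: "\<And>x y. x \<in> verts S i \<Longrightarrow> y \<in> verts S i \<Longrightarrow> vless T i (h x) (h y) \<Longrightarrow>
      parents T i (h x) \<inter> parents T i (h y) \<noteq> {} \<Longrightarrow> (x, y) \<in> circ_less S i"
    and "(h x, h y) \<in> circ_less T i" "x \<in> verts S i" "y \<in> verts S i"
  shows "(x, y) \<in> circ_less S i"
proof -
  \<comment> \<open>The endpoint is generalised to every \<open>y\<close> over \<open>t\<close>,
    because the induction must also apply to a freely chosen lift \<open>w\<close> of an
    intermediate vertex.\<close>
  have "(h x, t) \<in> circ_less T i \<Longrightarrow> h y = t \<Longrightarrow> y \<in> verts S i \<Longrightarrow> (x, y) \<in> circ_less S i" for t y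
    unfolding circ_less_def[of T]
  proof (induction arbitrary: y rule: trancl_induct)
    case (base t)
    then show ?case using gen assms(4) by blast
  next
    case (step t u)
    then have "t \<in> h ` verts S i" using surj by simp
    then obtain w where w: "w \<in> verts S i" "h w = t" by blast
    then have "(x, w) \<in> circ_less S i" using step.IH by blast
    moreover have "(w, y) \<in> circ_less S i" using gen w step by blast
    ultimately show ?case by (rule circ_less_trans)
  qed
  then show ?thesis using assms(3-5) by blast
qed

section \<open>Prenets and their maps\<close>

lemma prenet_two: "prenet S \<Longrightarrow> two_prenet S"
  unfolding prenet_def two_prenet_with_tassels_def by blast

lemma prenet_parents_interval:
  "prenet S \<Longrightarrow> i \<in> {1, 2} \<Longrightarrow> x \<in> verts S i \<Longrightarrow> parents S i x \<in> intervals S (i - 1)"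
  using prenet_two unfolding two_prenet_def by blast

lemma prenet_parents:
  assumes "prenet S" "i \<in> {1, 2}" "x \<in> verts S i"
  shows "parents S i x \<subseteq> verts S (i - 1)" "parents S i x \<noteq> {}"
  using prenet_parents_interval[OF assms] unfolding intervals_def by auto

lemma prenet_verts0: "prenet S \<Longrightarrow> \<exists>p. verts S 0 = {p}"
  unfolding prenet_def connected_prenet_def by (simp add: card_1_singleton_iff)

lemma prenet_parents_verts0: "prenet S \<Longrightarrow> x \<in> verts S 1 \<Longrightarrow> parents S 1 x = verts S 0"
  using prenet_parents[of S 1 x] prenet_verts0[of S] by auto

lemma prenet_ex_child:
  assumes "prenet S" "i \<in> {1, 2}" "t \<in> verts S (i - 1)"
  shows "\<exists>x\<in>verts S i. t \<in> parents S i x"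
proof -
  have "i - 1 \<in> {0, 1}" "i - 1 + 1 = i" using assms(2) by auto
  then have "children S i t \<noteq> {}" using assms(1,3) unfolding prenet_def pruned_def by metis
  then show ?thesis unfolding children_def by blast
qed

lemma prenet_map_range: "prenet_map S T f \<Longrightarrow> i \<in> {0, 1, 2} \<Longrightarrow> x \<in> verts S i \<Longrightarrow> f i x \<in> verts T i"
  unfolding prenet_map_def by (drule conjunct1, drule (1) bspec) blast

lemma prenet_map_circ_less:
  assumes "prenet_map S T f" "i \<in> {1, 2}" "x \<in> verts S i" "y \<in> verts S i"
    and "(x, y) \<in> circ_less S i"
  shows "(f i x, f i y) \<in> circ_less T i \<or> f i x = f i y"
  using assms(1)[unfolded prenet_map_def, THEN conjunct2, THEN conjunct1, THEN bspec, OF assms(2)]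
    assms(3-5) by blast

lemma prenet_map_fibre:
  assumes "prenet_map S T f" "i \<in> {1, 2}" "y \<in> verts T i"
  shows "preimage S f (i - 1) (parents T i y) = parents_of_set S i (preimage S f i {y})"
    and "disjoint_cover S i (minimal_children S i (preimage S f i {y}))
        (preimage S f (i - 1) (parents T i y))"
    and "disjoint_cover S i (maximal_children S i (preimage S f i {y}))
        (preimage S f (i - 1) (parents T i y))"
  using assms(1)[unfolded prenet_map_def, THEN conjunct2, THEN conjunct2, THEN conjunct1,
      THEN bspec, OF assms(2), THEN bspec, OF assms(3)]
    assms(1)[unfolded prenet_map_def, THEN conjunct2, THEN conjunct2, THEN conjunct2, THEN conjunct1,
      THEN bspec, OF assms(2), THEN bspec, OF assms(3)]
  by blast+

lemma prenet_map_core: "prenet_map S T f \<Longrightarrow> x \<in> core S \<Longrightarrow> f 2 x \<in> core T"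
  unfolding prenet_map_def by blast

lemma prenet_mapI:
  assumes "\<And>i x. i \<in> {0, 1, 2} \<Longrightarrow> x \<in> verts S i \<Longrightarrow> f i x \<in> verts T i"
    and "\<And>i x y. i \<in> {1, 2} \<Longrightarrow> x \<in> verts S i \<Longrightarrow> y \<in> verts S i \<Longrightarrow> (x, y) \<in> circ_less S i \<Longrightarrow>
      (f i x, f i y) \<in> circ_less T i \<or> f i x = f i y"
    and "\<And>i y. i \<in> {1, 2} \<Longrightarrow> y \<in> verts T i \<Longrightarrow>
      preimage S f (i - 1) (parents T i y) = parents_of_set S i (preimage S f i {y}) \<and>
      disjoint_cover S i (minimal_children S i (preimage S f i {y}))
        (preimage S f (i - 1) (parents T i y)) \<and>
      disjoint_cover S i (maximal_children S i (preimage S f i {y}))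
        (preimage S f (i - 1) (parents T i y))"
    and "\<And>x. x \<in> core S \<Longrightarrow> f 2 x \<in> core T"
  shows "prenet_map S T f"
  unfolding prenet_map_def
  by (intro conjI ballI impI image_subsetI assms(1,2,4) assms(3)[THEN conjunct1]
      assms(3)[THEN conjunct2, THEN conjunct1] assms(3)[THEN conjunct2, THEN conjunct2]; assumption)

text \<open>Goes up the levels from the single vertex at level 0. The parents of \<open>y\<close>
  are nonempty and have a nonempty preimage one level down; by the fibre equation that preimage
  consists of parents of the fibre over \<open>y\<close>, which therefore cannot be empty.\<close>

lemma prenet_map_surj:
  assumes S: "prenet S" and T: "prenet T" and f: "prenet_map S T f" and i: "i \<in> {0, 1, 2}"
  shows "f i ` verts S i = verts T i"
proof -
  have 0: "f 0 ` verts S 0 = verts T 0"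
    using prenet_verts0[OF S] prenet_verts0[OF T] prenet_map_range[OF f, of 0] by auto
  have step: "f k ` verts S k = verts T k"
    if k: "k \<in> {1, 2}" and surj: "f (k - 1) ` verts S (k - 1) = verts T (k - 1)" for k
  proof
    show "f k ` verts S k \<subseteq> verts T k" using prenet_map_range[OF f] k by blast
    show "verts T k \<subseteq> f k ` verts S k"
    proof
      fix y assume y: "y \<in> verts T k"
      have "parents_of_set S k (preimage S f k {y}) = preimage S f (k - 1) (parents T k y)"
        using prenet_map_fibre(1)[OF f k y] by simp
      moreover have "preimage S f (k - 1) (parents T k y) \<noteq> {}"
        using prenet_parents[OF T k y] unfolding preimage_def surj[symmetric] by blast
      ultimately show "y \<in> f k ` verts S k"
        unfolding parents_of_set_def preimage_def by blast
    qed
  qed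
  show ?thesis using 0 step[of 1] step[of 2] i by auto
qed

section \<open>Weak equivalences\<close>

text \<open>The definition gives this at level 2; at level 1 every parent set is the whole one-point
  level 0.\<close>

lemma weak_equivalence_parents:
  assumes "prenet S" "prenet T" and h: "weak_equivalence S T h"
    and i: "i \<in> {1, 2}" and x: "x \<in> verts S i"
  shows "parents S i x = preimage S h (i - 1) (parents T i (h i x))"
proof (cases "i = 2")
  case True
  then show ?thesis using h x unfolding weak_equivalence_def by auto
next
  case False
  then have [simp]: "i = 1" using i by simp
  have map: "prenet_map S T h" using h unfolding weak_equivalence_def by blast
  have "h 1 x \<in> verts T 1" using prenet_map_range[OF map, of 1] x by simp
  then show ?thesis
    using prenet_parents_verts0[OF assms(1)] prenet_parents_verts0[OF assms(2)] x
      prenet_map_range[OF map, of 0] unfolding preimage_def by auto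
qed

text \<open>A common parent of two images lifts to a common parent of the vertices, since parents
  are pulled back and \<open>h\<close> is surjective one level down. The vertices are then
  comparable, and the wrong orientation would be carried to a contradiction in
  \<open>T\<close>.\<close>

lemma weak_equivalence_circ_less_lift:
  assumes S: "prenet S" and T: "prenet T" and h: "weak_equivalence S T h" and i: "i \<in> {1, 2}"
    and "(h i x, h i y) \<in> circ_less T i" "x \<in> verts S i" "y \<in> verts S i"
  shows "(x, y) \<in> circ_less S i"
proof -
  have map: "prenet_map S T h" using h unfolding weak_equivalence_def by blast
  have i': "i \<in> {0, 1, 2}" "i - 1 \<in> {0, 1, 2}" using i by auto
  note surj = prenet_map_surj[OF S T map]
  show ?thesis
  proof (rule circ_less_lift[OF surj[OF i'(1)] _ assms(5-7)])
    fix x y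
    assume x: "x \<in> verts S i" and y: "y \<in> verts S i" and less: "vless T i (h i x) (h i y)"
      and "parents T i (h i x) \<inter> parents T i (h i y) \<noteq> {}"
    then obtain t where t: "t \<in> parents T i (h i x)" "t \<in> parents T i (h i y)" by blast
    have "t \<in> verts T (i - 1)"
      using t(1) prenet_parents(1)[OF T i] prenet_map_range[OF map i'(1) x] by blast
    then have "t \<in> h (i - 1) ` verts S (i - 1)" using surj[OF i'(2)] by simp
    then obtain r where "r \<in> verts S (i - 1)" "h (i - 1) r = t" by blast
    then have common: "parents S i x \<inter> parents S i y \<noteq> {}"
      using t weak_equivalence_parents[OF S T h i] x y unfolding preimage_def by blast
    have "\<not> vless S i y x"
    proof
      assume "vless S i y x"
      then have "(y, x) \<in> circ_less S i" using circ_lessI[OF y x] common by (simp add: Int_commute)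
      then have "(h i y, h i x) \<in> circ_less T i \<or> h i y = h i x"
        using prenet_map_circ_less[OF map i y x] by blast
      then show False
        using less circ_less_vless[OF prenet_two[OF T] i'(1)] vless_asym[OF prenet_two[OF T] i'(1)]
        unfolding vless_def by metis
    qed
    moreover have "x \<noteq> y" using less unfolding vless_def by blast
    ultimately have "vless S i x y" using vless_total[OF prenet_two[OF S] i'(1) x y] by blast
    then show "(x, y) \<in> circ_less S i" using circ_lessI[OF x y _ common] by blast
  qed
qed

section \<open>The staircase\<close>

text \<open>The value \<open>c i y\<close> of a section of \<open>g\<close> marks the vertex
  \<open>x_j\<close> in the fibre over \<open>y\<close>. At level 0, where
  \<open>parents S 0\<close> is arbitrary, only the first disjunct can hold in the situation below,
  as \<open>T'\<close> has a single vertex there.\<close>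

definition staircase :: "'a prenet_data \<Rightarrow> 'c prenet_data \<Rightarrow> (nat \<Rightarrow> 'a \<Rightarrow> 'b) \<Rightarrow> (nat \<Rightarrow> 'c \<Rightarrow> 'b)
    \<Rightarrow> (nat \<Rightarrow> 'b \<Rightarrow> 'c) \<Rightarrow> nat \<Rightarrow> ('a \<times> 'c) set" where
  "staircase S T' f g c i = {(s, x). s \<in> verts S i \<and> x \<in> verts T' i \<and> g i x = f i s \<and>
     (x = c i (f i s) \<or>
      vless T' i x (c i (f i s)) \<and> s \<in> minimal_children S i (preimage S f i {f i s}) \<or>
      vless T' i (c i (f i s)) x \<and> s \<in> maximal_children S i (preimage S f i {f i s}))}"

text \<open>The bijections \<open>V i \<rightarrow> staircase i\<close> serve to have a copy of the staircase with vertices in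
  any type, such as \<open>nat\<close>.\<close>

locale staircase_square =
  fixes S :: "'a prenet_data" and T :: "'b prenet_data" and T' :: "'c prenet_data"
    and f :: "nat \<Rightarrow> 'a \<Rightarrow> 'b" and g :: "nat \<Rightarrow> 'c \<Rightarrow> 'b" and c :: "nat \<Rightarrow> 'b \<Rightarrow> 'c"
    and V :: "nat \<Rightarrow> 'd set" and f' :: "nat \<Rightarrow> 'd \<Rightarrow> 'c" and g' :: "nat \<Rightarrow> 'd \<Rightarrow> 'a"
  assumes S: "prenet S" and T: "prenet T" and T': "prenet T'"
    and f: "prenet_map S T f" and weq: "weak_equivalence T' T g"
    and c_verts: "\<And>i y. i \<in> {0, 1, 2} \<Longrightarrow> y \<in> verts T i \<Longrightarrow> c i y \<in> verts T' i"
    and g_c: "\<And>i y. i \<in> {0, 1, 2} \<Longrightarrow> y \<in> verts T i \<Longrightarrow> g i (c i y) = y"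
    and c_core: "\<And>y. y \<in> core T \<Longrightarrow> c 2 y \<in> core T'"
    and bij: "\<And>i. i \<in> {0, 1, 2} \<Longrightarrow>
      bij_betw (\<lambda>v. (g' i v, f' i v)) (V i) (staircase S T' f g c i)"
begin

text \<open>The order is lexicographic with \<open>S\<close> first. Parents are all lifts of parents
  in \<open>S\<close>, so \<open>g'\<close> satisfies the parent condition of a weak equivalence by
  construction. The core is the largest one that both projections send to core vertices.\<close>

definition P :: "'d prenet_data" where
  "P = \<lparr>verts = V,
        vle = (\<lambda>i. {(v, w). v \<in> V i \<and> w \<in> V i \<and>
          (vless S i (g' i v) (g' i w) \<or> g' i v = g' i w \<and> (f' i v, f' i w) \<in> vle T' i)}),
        parents = (\<lambda>i v. {t \<in> V (i - 1). g' (i - 1) t \<in> parents S i (g' i v)}),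
        tassels = {v \<in> V 2. \<not> (g' 2 v \<in> core S \<and> f' 2 v \<in> core T')}\<rparr>"

lemma verts_P [simp]: "verts P i = V i"
  by (simp add: P_def)

lemma parents_P: "parents P i v = {t \<in> V (i - 1). g' (i - 1) t \<in> parents S i (g' i v)}"
  by (simp add: P_def)

lemma core_P: "core P = {v \<in> V 2. g' 2 v \<in> core S \<and> f' 2 v \<in> core T'}"
  by (auto simp: P_def core_def)

lemma staircase_iff:
  "i \<in> {0, 1, 2} \<Longrightarrow> (s, x) \<in> staircase S T' f g c i \<longleftrightarrow> (\<exists>v\<in>V i. g' i v = s \<and> f' i v = x)"
  by (subst bij_betw_imp_surj_on[OF bij, symmetric]) auto

lemma V_eqI:
  "i \<in> {0, 1, 2} \<Longrightarrow> v \<in> V i \<Longrightarrow> w \<in> V i \<Longrightarrow> g' i v = g' i w \<Longrightarrow> f' i v = f' i w \<Longrightarrow> v = w"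
  using bij_betw_imp_inj_on[OF bij] by (auto dest: inj_onD)

lemma g: "prenet_map T' T g" "weak_equivalence T' T g"
  using weq unfolding weak_equivalence_def by auto

lemma projections:
  assumes "i \<in> {0, 1, 2}" "v \<in> V i"
  shows "g' i v \<in> verts S i" "f' i v \<in> verts T' i" "g i (f' i v) = f i (g' i v)"
  using staircase_iff[OF assms(1), of "g' i v" "f' i v"] assms(2) unfolding staircase_def by auto

lemma staircase_cases:
  assumes "i \<in> {0, 1, 2}" "v \<in> V i"
  shows "f' i v = c i (f i (g' i v)) \<or>
      vless T' i (f' i v) (c i (f i (g' i v)))
        \<and> g' i v \<in> minimal_children S i (preimage S f i {f i (g' i v)}) \<or>
      vless T' i (c i (f i (g' i v))) (f' i v)
        \<and> g' i v \<in> maximal_children S i (preimage S f i {f i (g' i v)})"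
  using staircase_iff[OF assms(1), of "g' i v" "f' i v"] assms(2) unfolding staircase_def by auto

text \<open>The marked vertex is paired with the whole fibre of \<open>f\<close>, so every vertex of
  \<open>S\<close> has a lift; core vertices get their core lifts in this way.\<close>

lemma staircase_c:
  assumes "i \<in> {0, 1, 2}" "s \<in> verts S i"
  shows "\<exists>v\<in>V i. g' i v = s \<and> f' i v = c i (f i s)"
proof -
  have "f i s \<in> verts T i" using prenet_map_range[OF f assms] .
  then have "(s, c i (f i s)) \<in> staircase S T' f g c i"
    using c_verts g_c assms unfolding staircase_def by auto
  then show ?thesis using staircase_iff[OF assms(1)] by blast
qed

lemma g'_surj: "i \<in> {0, 1, 2} \<Longrightarrow> g' i ` V i = verts S i"
  using projections(1) staircase_c by blast

lemma vless_P:
  "vless P i v w \<longleftrightarrow> v \<in> V i \<and> w \<in> V i \<and>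
     (vless S i (g' i v) (g' i w) \<or>
      g' i v = g' i w \<and> (f' i v, f' i w) \<in> vle T' i \<and> v \<noteq> w)"
  by (auto simp: vless_def P_def)

lemma vle_P:
  "(v, w) \<in> vle P i \<longleftrightarrow> v \<in> V i \<and> w \<in> V i \<and>
     (vless S i (g' i v) (g' i w) \<or> g' i v = g' i w \<and> (f' i v, f' i w) \<in> vle T' i)"
  by (auto simp: P_def)

section \<open>The prenet axioms for \<open>P\<close>\<close>

lemma finite_V: "i \<in> {0, 1, 2} \<Longrightarrow> finite (V i)"
proof -
  assume i: "i \<in> {0, 1, 2}"
  have "staircase S T' f g c i \<subseteq> verts S i \<times> verts T' i" unfolding staircase_def by auto
  then have "finite (staircase S T' f g c i)"
    using finite_verts[OF prenet_two[OF S] i] finite_verts[OF prenet_two[OF T'] i]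
      finite_subset by blast
  then show ?thesis using bij_betw_finite[OF bij[OF i]] by blast
qed

lemma linear_order_P:
  assumes i: "i \<in> {0, 1, 2}"
  shows "linear_order_on (verts P i) (vle P i)"
proof -
  note ordS = vless_total[OF prenet_two[OF S] i] vless_asym[OF prenet_two[OF S] i]
    vless_trans[OF prenet_two[OF S] i]
  note ordT = vle_refl[OF prenet_two[OF T'] i] vle_trans[OF prenet_two[OF T'] i]
    vle_antisym[OF prenet_two[OF T'] i] vless_total[OF prenet_two[OF T'] i, unfolded vless_def]
  have "refl_on (V i) (vle P i)"
    unfolding refl_on_def vle_P using projections[OF i] ordT(1) by auto
  moreover have "vle P i \<subseteq> V i \<times> V i" using vle_P by auto
  moreover have "trans (vle P i)"
  proof (rule transI)
    fix u v w assume "(u, v) \<in> vle P i" "(v, w) \<in> vle P i"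
    then show "(u, w) \<in> vle P i" unfolding vle_P using ordS(3) ordT(2) by metis
  qed
  moreover have "antisym (vle P i)"
  proof (rule antisymI)
    fix u v assume a: "(u, v) \<in> vle P i" "(v, u) \<in> vle P i"
    then have "g' i u = g' i v \<and> f' i u = f' i v"
      unfolding vle_P using ordS(2) ordT(3) by metis
    then show "u = v" using V_eqI[OF i] a unfolding vle_P by blast
  qed
  moreover have "total_on (V i) (vle P i)"
  proof (rule total_onI)
    fix u v assume a: "u \<in> V i" "v \<in> V i" "u \<noteq> v"
    then have "g' i u \<noteq> g' i v \<or> f' i u \<noteq> f' i v" using V_eqI[OF i] by blast
    then show "(u, v) \<in> vle P i \<or> (v, u) \<in> vle P i"
      unfolding vle_P using a projections[OF i] ordS(1) ordT(4) ordT(1) by metis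
  qed
  ultimately show ?thesis unfolding order_on_defs by simp
qed

lemma levels: "i \<in> {1, 2} \<Longrightarrow> i \<in> {0, 1, 2}" "i \<in> {1, 2} \<Longrightarrow> i - 1 \<in> {0, 1, 2::nat}"
  by auto

text \<open>Every common parent in \<open>S\<close> has a lift, by surjectivity of \<open>g'\<close>
  one level below. Hence the generators of \<open>circ_less P i\<close> can be recognised in
  \<open>S\<close>.\<close>

lemma parents_P_Int:
  assumes i: "i \<in> {1, 2}" and v: "v \<in> V i" "w \<in> V i"
  shows "parents P i v \<inter> parents P i w \<noteq> {} \<longleftrightarrow>
    parents S i (g' i v) \<inter> parents S i (g' i w) \<noteq> {}"
proof -
  have "parents S i (g' i v) \<subseteq> g' (i - 1) ` V (i - 1)"
    using prenet_parents(1)[OF S i] projections(1)[OF levels(1)[OF i] v(1)] g'_surj[OF levels(2)[OF i]]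
    by blast
  then show ?thesis unfolding parents_P by blast
qed

lemma parents_P_ne:
  assumes i: "i \<in> {1, 2}" and v: "v \<in> V i"
  shows "parents P i v \<noteq> {}"
  using parents_P_Int[OF i v v] prenet_parents(2)[OF S i] projections(1)[OF levels(1)[OF i] v] by auto

text \<open>The projection \<open>g'\<close> is weakly monotone, so preimages of intervals are
  convex. Strict betweenness in \<open>P\<close> may collapse to equality in \<open>S\<close>,
  whence the two disjunctions in the proof.\<close>

lemma parents_P_interval:
  assumes i: "i \<in> {1, 2}" and v: "v \<in> V i"
  shows "parents P i v \<in> intervals P (i - 1)"
proof -
  define J where "J = parents S i (g' i v)"
  have J: "J \<in> intervals S (i - 1)"
    using prenet_parents_interval[OF S i] projections(1)[OF levels(1)[OF i] v] J_def by blast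
  have "u \<in> parents P i v"
    if "t \<in> parents P i v" "w \<in> parents P i v" "vless P (i - 1) t u" "vless P (i - 1) u w" for t u w
  proof -
    have tw: "g' (i - 1) t \<in> J" "g' (i - 1) w \<in> J" using that unfolding parents_P J_def by auto
    have u: "u \<in> V (i - 1)" using that(3) unfolding vless_P by blast
    then have "g' (i - 1) u \<in> verts S (i - 1)" using projections(1)[OF levels(2)[OF i]] by blast
    moreover have "g' (i - 1) u = g' (i - 1) t \<or> vless S (i - 1) (g' (i - 1) t) (g' (i - 1) u)"
      "g' (i - 1) u = g' (i - 1) w \<or> vless S (i - 1) (g' (i - 1) u) (g' (i - 1) w)"
      using that(3,4) unfolding vless_P by auto
    moreover have "\<forall>x\<in>J. \<forall>z\<in>J. \<forall>y\<in>verts S (i - 1). vless S (i - 1) x y \<and> vless S (i - 1) y z \<longrightarrow> y \<in> J"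
      using J unfolding intervals_def mem_Collect_eq by (elim conjE)
    ultimately have "g' (i - 1) u \<in> J" using tw by metis
    then show ?thesis using u unfolding parents_P J_def by blast
  qed
  moreover have "parents P i v \<subseteq> V (i - 1)" unfolding parents_P by blast
  ultimately show ?thesis using parents_P_ne[OF i v]
    unfolding intervals_def mem_Collect_eq verts_P by blast
qed

lemma circ_less_P_lift:
  assumes i: "i \<in> {1, 2}" and "(g' i v, g' i w) \<in> circ_less S i" "v \<in> V i" "w \<in> V i"
  shows "(v, w) \<in> circ_less P i"
proof (rule circ_less_lift[where h = "g' i" and T = S])
  show "g' i ` verts P i = verts S i" using g'_surj[OF levels(1)[OF i]] by simp
  fix x y assume "x \<in> verts P i" "y \<in> verts P i" "vless S i (g' i x) (g' i y)"
    "parents S i (g' i x) \<inter> parents S i (g' i y) \<noteq> {}"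
  then show "(x, y) \<in> circ_less P i"
    using circ_lessI[of x P i y] parents_P_Int[OF i] by (simp add: vless_P)
qed (use assms in auto)

text \<open>Vertices over the same \<open>s\<close> share parents and are comparable. An
  incomparable pair therefore has distinct images in \<open>S\<close>, again incomparable by
  \<open>circ_less_P_lift\<close>, and the separation of their parents there lifts to
  \<open>P\<close>.\<close>

lemma two_prenet_P: "two_prenet P"
proof -
  have "set_less P (i - 1) (parents P i v) (parents P i w)"
    if i: "i \<in> {1, 2}" and v: "v \<in> V i" and w: "w \<in> V i" and less: "vless P i v w"
      and inc: "(v, w) \<notin> circ_less P i" "(w, v) \<notin> circ_less P i" for i v w
  proof -
    note vw = projections(1)[OF levels(1)[OF i] v] projections(1)[OF levels(1)[OF i] w]
    have "g' i v \<noteq> g' i w"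
    proof
      assume "g' i v = g' i w"
      then have "parents P i v \<inter> parents P i w \<noteq> {}"
        using parents_P_Int[OF i v w] prenet_parents(2)[OF S i vw(1)] by simp
      then show False using inc(1) circ_lessI less v w by (metis verts_P)
    qed
    then have "vless S i (g' i v) (g' i w)" using less unfolding vless_P by blast
    then have "set_less S (i - 1) (parents S i (g' i v)) (parents S i (g' i w))"
      using prenet_two[OF S] i vw inc circ_less_P_lift[OF i] v w unfolding two_prenet_def by blast
    then show ?thesis unfolding set_less_def vless_P parents_P by blast
  qed
  then show ?thesis
    unfolding two_prenet_def using finite_V linear_order_P parents_P_interval by auto
qed

lemma prenet_P: "prenet P"
proof -
  have "connected_prenet P"
  proof -
    obtain s x where sx: "verts S 0 = {s}" "verts T' 0 = {x}"
      using prenet_verts0[OF S] prenet_verts0[OF T'] by blast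
    have "V 0 \<noteq> {}" using g'_surj[of 0] sx by auto
    moreover have "u = v" if "u \<in> V 0" "v \<in> V 0" for u v
      using V_eqI[of 0 u v] projections[of 0] that sx by auto
    ultimately have "\<exists>v. V 0 = {v}" by blast
    then show ?thesis unfolding connected_prenet_def by auto
  qed
  moreover have "children P (i + 1) t \<noteq> {}" if i: "i \<in> {0, 1}" and t: "t \<in> V i" for i t
  proof -
    have k: "i + 1 \<in> {1, 2}" using i by auto
    have "g' i t \<in> verts S i" using projections(1) t i by blast
    then obtain s where s: "s \<in> verts S (i + 1)" "g' i t \<in> parents S (i + 1) s"
      using prenet_ex_child[OF S k, of "g' i t"] by auto
    obtain v where "v \<in> V (i + 1)" "g' (i + 1) v = s" using staircase_c[OF levels(1)[OF k] s(1)] by blast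
    then show ?thesis using s(2) t unfolding children_def parents_P by auto
  qed
  moreover have "tassels P \<subseteq> verts P 2" by (auto simp: P_def)
  ultimately show ?thesis
    using two_prenet_P unfolding prenet_def two_prenet_with_tassels_def pruned_def by auto
qed

section \<open>The projection \<open>g'\<close> to \<open>S\<close>\<close>

lemma circ_less_g':
  assumes i: "i \<in> {1, 2}" and "(v, w) \<in> circ_less P i"
  shows "(g' i v, g' i w) \<in> circ_less S i \<or> g' i v = g' i w"
proof (rule circ_less_map[OF _ assms(2)])
  fix x y assume a: "x \<in> verts P i" "y \<in> verts P i" "vless P i x y"
    "parents P i x \<inter> parents P i y \<noteq> {}"
  then have "vless S i (g' i x) (g' i y) \<or> g' i x = g' i y" unfolding vless_P by blast
  moreover have "parents S i (g' i x) \<inter> parents S i (g' i y) \<noteq> {}"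
    using parents_P_Int[OF i] a by simp
  ultimately show "(g' i x, g' i y) \<in> circ_less S i \<or> g' i x = g' i y"
    using circ_lessI[of "g' i x" S i "g' i y"] projections(1)[OF levels(1)[OF i]] a by auto
qed

text \<open>Fibres of \<open>g'\<close> have constant parents, which settles the covers. On cores,
  injectivity comes from that of \<open>g 2\<close> on \<open>core T'\<close>, and surjectivity from
  \<open>c_core\<close>.\<close>

lemma weak_equivalence_g': "weak_equivalence P S g'"
proof -
  have par: "parents P i v = preimage P g' (i - 1) (parents S i (g' i v))" for i v
    unfolding parents_P preimage_def by simp
  have cover: "preimage P g' (i - 1) (parents S i s) = parents_of_set P i (preimage P g' i {s}) \<and>
      disjoint_cover P i (minimal_children P i (preimage P g' i {s}))
        (preimage P g' (i - 1) (parents S i s)) \<and>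
      disjoint_cover P i (maximal_children P i (preimage P g' i {s}))
        (preimage P g' (i - 1) (parents S i s))"
    if i: "i \<in> {1, 2}" and s: "s \<in> verts S i" for i s
  proof -
    define U where "U = preimage P g' i {s}"
    define W where "W = preimage P g' (i - 1) (parents S i s)"
    have U: "U \<subseteq> verts P i" unfolding U_def preimage_def by blast
    have ne: "U \<noteq> {}" using staircase_c[OF levels(1)[OF i] s] unfolding U_def preimage_def by auto
    have UW: "parents P i v = W" if "v \<in> U" for v
      using that par unfolding U_def W_def preimage_def by auto
    obtain v where v: "v \<in> U" "v \<in> V i" using ne U by auto
    have W: "W \<subseteq> verts P (i - 1)" "W \<noteq> {}"
      using parents_P_ne[OF i v(2)] unfolding UW[OF v(1), symmetric] by (auto simp: parents_P)
    have "parents_of_set P i U = W" using ne by (auto simp: parents_of_set_def UW)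
    then show ?thesis
      using disjoint_cover_extremal_children_const[OF two_prenet_P levels(1)[OF i] U ne UW W]
      unfolding U_def W_def by simp
  qed
  have core: "bij_betw (g' 2) (core P) (core S)"
  proof (rule bij_betw_imageI)
    have inj: "inj_on (g 2) (core T')" using g(2) unfolding weak_equivalence_def bij_betw_def by blast
    show "inj_on (g' 2) (core P)"
    proof (rule inj_onI)
      fix v w assume vw: "v \<in> core P" "w \<in> core P" "g' 2 v = g' 2 w"
      then have "g 2 (f' 2 v) = g 2 (f' 2 w)" using projections(3)[of 2] unfolding core_P by auto
      then have "f' 2 v = f' 2 w" using inj vw unfolding core_P by (auto dest: inj_onD)
      then show "v = w" using V_eqI[of 2 v w] vw unfolding core_P by auto
    qed
    have "s \<in> g' 2 ` core P" if s: "s \<in> core S" for s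
    proof -
      have "f 2 s \<in> core T" using prenet_map_core[OF f s] .
      then have "c 2 (f 2 s) \<in> core T'" by (rule c_core)
      moreover obtain v where "v \<in> V 2" "g' 2 v = s" "f' 2 v = c 2 (f 2 s)"
        using staircase_c[of 2 s] s unfolding core_def by auto
      ultimately show ?thesis using s unfolding core_P by auto
    qed
    then show "g' 2 ` core P = core S" unfolding core_P by auto
  qed
  have "prenet_map P S g'"
    by (intro prenet_mapI cover) (use projections(1) circ_less_g' core_P in auto)
  then show ?thesis using core par unfolding weak_equivalence_def by auto
qed

section \<open>The projection \<open>f'\<close> to \<open>T'\<close>\<close>

text \<open>If \<open>g' v < g' w\<close> have a common parent and lie in one fibre of \<open>f\<close>, then \<open>g' w\<close> is not in
  \<open>A\<close> and \<open>g' v\<close> is not in \<open>B\<close>, so that \<open>f' v \<le> c \<le> f' w\<close> by the shape of the staircase.\<close>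

lemma circ_less_f':
  assumes i: "i \<in> {1, 2}" and "(v, w) \<in> circ_less P i"
  shows "(f' i v, f' i w) \<in> circ_less T' i \<or> f' i v = f' i w"
proof (rule circ_less_map[OF _ assms(2)])
  fix v w assume "v \<in> verts P i" "w \<in> verts P i" and less: "vless P i v w"
    and common: "parents P i v \<inter> parents P i w \<noteq> {}"
  then have v: "v \<in> V i" and w: "w \<in> V i" by auto
  note i0 = levels(1)[OF i]
  note pv = projections[OF i0 v] and pw = projections[OF i0 w]
  \<comment> \<open>Within one fibre of \<open>g\<close> all parent sets coincide, so the total
    order there is already \<open>circ_less\<close> or equality.\<close>
  have circ: "(f' i v, f' i w) \<in> circ_less T' i \<or> f' i v = f' i w"
    if eq: "f i (g' i v) = f i (g' i w)" and le: "(f' i v, f' i w) \<in> vle T' i"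
  proof (cases "f' i v = f' i w")
    case False
    have "parents T' i (f' i v) = parents T' i (f' i w)"
      using weak_equivalence_parents[OF T' T g(2) i] pv pw eq by simp
    then show ?thesis
      using circ_lessI[of "f' i v" T' i "f' i w"] False le pv pw prenet_parents(2)[OF T' i]
      unfolding vless_def by auto
  qed simp
  have scommon: "parents S i (g' i v) \<inter> parents S i (g' i w) \<noteq> {}"
    using common parents_P_Int[OF i v w] by blast
  consider "g' i v = g' i w" "(f' i v, f' i w) \<in> vle T' i" | "vless S i (g' i v) (g' i w)"
    using less unfolding vless_P by blast
  then show "(f' i v, f' i w) \<in> circ_less T' i \<or> f' i v = f' i w"
  proof cases
    case 1
    then show ?thesis using circ by simp
  next
    case 2
    then have "(g' i v, g' i w) \<in> circ_less S i" using circ_lessI pv pw scommon by metis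
    then consider "(f i (g' i v), f i (g' i w)) \<in> circ_less T i" | "f i (g' i v) = f i (g' i w)"
      using prenet_map_circ_less[OF f i pv(1) pw(1)] by blast
    then show ?thesis
    proof cases
      \<comment> \<open>The images in \<open>T\<close> are strictly related, and \<open>g\<close>
        reflects \<open>circ_less\<close>.\<close>
      case 1
      then show ?thesis
        using weak_equivalence_circ_less_lift[OF T' T g(2) i, of "f' i v" "f' i w"] pv pw by simp
    next
      case eq: 2
      define y where "y = f i (g' i v)"
      define U where "U = preimage S f i {y}"
      have y: "y \<in> verts T i" using prenet_map_range[OF f i0] pv unfolding y_def by blast
      have U: "U \<subseteq> verts S i" "g' i v \<in> U" "g' i w \<in> U"
        using pv pw eq unfolding U_def preimage_def y_def by auto
      obtain z where z: "z \<in> parents S i (g' i v)" "z \<in> parents S i (g' i w)"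
        using scommon by blast
      have disj: "disjoint_family_on (parents S i) (minimal_children S i U)"
        "disjoint_family_on (parents S i) (maximal_children S i U)"
        using prenet_map_fibre[OF f i y] unfolding U_def disjoint_cover_def by blast+
      have "g' i w \<notin> minimal_children S i U"
        using disjoint_minimal_children_least[OF prenet_two[OF S] i0 disj(1) U(1) _ U(2) z(2,1)] 2
        by blast
      moreover have "g' i v \<notin> maximal_children S i U"
        using disjoint_maximal_children_greatest[OF prenet_two[OF S] i0 disj(2) U(1) _ U(3) z] 2
        by blast
      moreover have cy: "c i y \<in> verts T' i" using c_verts[OF i0 y] .
      ultimately have "(f' i v, c i y) \<in> vle T' i" "(c i y, f' i w) \<in> vle T' i"
        using staircase_cases[OF i0 v] staircase_cases[OF i0 w]
          vle_refl[OF prenet_two[OF T'] i0 cy] eq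
        unfolding vless_def y_def U_def by auto
      then show ?thesis using circ[OF eq] vle_trans[OF prenet_two[OF T'] i0] by blast
    qed
  qed
qed

text \<open>The fibre of \<open>f'\<close> over \<open>x\<close> is one row of the staircase; its
  shape depends on whether \<open>x\<close> equals, precedes or follows the marked vertex
  \<open>c i (g i x)\<close>.\<close>

lemma image_fibre:
  assumes i: "i \<in> {1, 2}" and x: "x \<in> verts T' i"
  defines "U \<equiv> preimage S f i {g i x}"
  shows "g' i ` preimage P f' i {x} = U \<or>
    g' i ` preimage P f' i {x} = minimal_children S i U \<or>
    g' i ` preimage P f' i {x} = maximal_children S i U"
proof -
  note i0 = levels(1)[OF i]
  have gx: "g i x \<in> verts T i" using prenet_map_range[OF g(1) i0 x] .
  have "g' i ` preimage P f' i {x} = {s. (s, x) \<in> staircase S T' f g c i}"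
    using staircase_iff[OF i0] unfolding preimage_def by auto
  also have "\<dots> = {s \<in> U. x = c i (g i x) \<or>
      vless T' i x (c i (g i x)) \<and> s \<in> minimal_children S i U \<or>
      vless T' i (c i (g i x)) x \<and> s \<in> maximal_children S i U}"
    unfolding staircase_def U_def using x by (auto simp: preimage_def)
  finally have image: "g' i ` preimage P f' i {x} = \<dots>" .
  have sub: "minimal_children S i U \<subseteq> U" "maximal_children S i U \<subseteq> U"
    unfolding minimal_children_def maximal_children_def by auto
  consider "x = c i (g i x)"
    | "vless T' i x (c i (g i x))" "\<not> vless T' i (c i (g i x)) x" "x \<noteq> c i (g i x)"
    | "vless T' i (c i (g i x)) x" "\<not> vless T' i x (c i (g i x))" "x \<noteq> c i (g i x)"
    using vless_total[OF prenet_two[OF T'] i0 x c_verts[OF i0 gx]]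
      vless_asym[OF prenet_two[OF T'] i0] by blast
  then show ?thesis
  proof cases
    case 1
    then show ?thesis unfolding image by blast
  next
    case 2
    then have "{s \<in> U. s \<in> minimal_children S i U} = g' i ` preimage P f' i {x}"
      unfolding image by blast
    then show ?thesis using sub by blast
  next
    case 3
    then have "{s \<in> U. s \<in> maximal_children S i U} = g' i ` preimage P f' i {x}"
      unfolding image by blast
    then show ?thesis using sub by blast
  qed
qed

text \<open>For a full row these are the fibre conditions on \<open>f\<close>. The other rows are
  disjoint covers of \<open>W\<close> themselves, hence equal to their own minimal and maximal
  children.\<close>

lemma fibre_extremal_covers:
  assumes i: "i \<in> {1, 2}" and x: "x \<in> verts T' i"
  defines "X \<equiv> g' i ` preimage P f' i {x}"
    and "W \<equiv> preimage S f (i - 1) (parents T i (g i x))"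
  shows "parents_of_set S i X = W"
    and "disjoint_cover S i (minimal_children S i X) W"
    and "disjoint_cover S i (maximal_children S i X) W"
proof -
  define U where "U = preimage S f i {g i x}"
  have gx: "g i x \<in> verts T i" using prenet_map_range[OF g(1) levels(1)[OF i] x] .
  have W: "parents_of_set S i U = W" using prenet_map_fibre(1)[OF f i gx] unfolding U_def W_def by simp
  have A: "disjoint_cover S i (minimal_children S i U) W"
    and B: "disjoint_cover S i (maximal_children S i U) W"
    using prenet_map_fibre[OF f i gx] unfolding U_def W_def by auto
  have fixed: "minimal_children S i Y = Y" "maximal_children S i Y = Y" "parents_of_set S i Y = W"
    if "disjoint_cover S i Y W" for Y
  proof -
    have Y: "disjoint_family_on (parents S i) Y" "Y \<subseteq> verts S i"
      using that unfolding disjoint_cover_def by auto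
    then have "parents S i s \<noteq> {}" if "s \<in> Y" for s using prenet_parents(2)[OF S i] that by blast
    then show "minimal_children S i Y = Y" "maximal_children S i Y = Y"
      using minimal_children_disjoint[OF Y] maximal_children_disjoint[OF Y] by auto
    show "parents_of_set S i Y = W"
      using that unfolding disjoint_cover_def parents_of_set_def by blast
  qed
  have "X = U \<or> X = minimal_children S i U \<or> X = maximal_children S i U"
    using image_fibre[OF i x] unfolding X_def U_def .
  then show "parents_of_set S i X = W"
    "disjoint_cover S i (minimal_children S i X) W"
    "disjoint_cover S i (maximal_children S i X) W"
    using W A B fixed[OF A] fixed[OF B] by metis+
qed

text \<open>Where \<open>g'\<close> is injective, the lexicographic order is that of
  \<open>S\<close>; a witnessing parent in \<open>S\<close> lifts to one in
  \<open>P\<close>.\<close>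

lemma extremal_children_P:
  assumes i: "i \<in> {1, 2}" and U: "U \<subseteq> V i" and inj: "inj_on (g' i) U"
  shows "minimal_children P i U = {v \<in> U. g' i v \<in> minimal_children S i (g' i ` U)}"
    and "maximal_children P i U = {v \<in> U. g' i v \<in> maximal_children S i (g' i ` U)}"
proof -
  note i0 = levels(1)[OF i]
  have ord: "vless P i v w \<longleftrightarrow> vless S i (g' i v) (g' i w)" if "v \<in> U" "w \<in> U" for v w
    using that U inj unfolding vless_P by (auto dest: inj_onD)
  have gU: "g' i v \<in> verts S i" if "v \<in> U" for v using projections(1)[OF i0] U that by blast
  have parS: "\<exists>t\<in>V (i - 1). g' (i - 1) t = z" if "z \<in> parents S i (g' i v)" "v \<in> U" for z v
    using staircase_c[OF levels(2)[OF i]] prenet_parents(1)[OF S i gU[OF that(2)]] that(1) by blast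
  have U': "U \<subseteq> verts P i" "g' i ` U \<subseteq> verts S i" using U gU by auto
  have mnP: "v \<in> minimal_children P i U \<longleftrightarrow> v \<in> U \<and> (\<exists>t\<in>V (i - 1).
      g' (i - 1) t \<in> parents S i (g' i v) \<and>
      (\<forall>w\<in>U. g' (i - 1) t \<in> parents S i (g' i w) \<longrightarrow> \<not> vless S i (g' i w) (g' i v)))" for v
    unfolding minimal_children_iff[OF U'(1)] parents_P using ord by blast
  have mxP: "v \<in> maximal_children P i U \<longleftrightarrow> v \<in> U \<and> (\<exists>t\<in>V (i - 1).
      g' (i - 1) t \<in> parents S i (g' i v) \<and>
      (\<forall>w\<in>U. g' (i - 1) t \<in> parents S i (g' i w) \<longrightarrow> \<not> vless S i (g' i v) (g' i w)))" for v
    unfolding maximal_children_iff[OF U'(1)] parents_P using ord by blast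
  show "minimal_children P i U = {v \<in> U. g' i v \<in> minimal_children S i (g' i ` U)}"
    unfolding set_eq_iff mem_Collect_eq mnP minimal_children_iff[OF U'(2)] using parS by blast
  show "maximal_children P i U = {v \<in> U. g' i v \<in> maximal_children S i (g' i ` U)}"
    unfolding set_eq_iff mem_Collect_eq mxP maximal_children_iff[OF U'(2)] using parS by blast
qed

lemma disjoint_cover_P:
  assumes i: "i \<in> {1, 2}" and U: "U \<subseteq> V i" and inj: "inj_on (g' i) U"
    and Y: "Y \<subseteq> g' i ` U" "disjoint_cover S i Y W"
  shows "disjoint_cover P i {v \<in> U. g' i v \<in> Y} (preimage P g' (i - 1) W)"
proof -
  have disj: "disjoint_family_on (parents S i) Y" and W: "(\<Union>s\<in>Y. parents S i s) = W"
    using Y(2) unfolding disjoint_cover_def by auto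
  have "disjoint_family_on (parents P i) {v \<in> U. g' i v \<in> Y}"
    unfolding disjoint_family_on_def
  proof (intro ballI impI)
    fix v w assume vw: "v \<in> {v \<in> U. g' i v \<in> Y}" "w \<in> {v \<in> U. g' i v \<in> Y}" "v \<noteq> w"
    then have "g' i v \<noteq> g' i w" using inj by (auto dest: inj_onD)
    then have "parents S i (g' i v) \<inter> parents S i (g' i w) = {}"
      using disj vw unfolding disjoint_family_on_def by blast
    then show "parents P i v \<inter> parents P i w = {}" unfolding parents_P by blast
  qed
  moreover have "(\<Union>v\<in>{v \<in> U. g' i v \<in> Y}. parents P i v) = preimage P g' (i - 1) W"
    using Y(1) unfolding parents_P preimage_def W[symmetric] by auto
  ultimately show ?thesis using U unfolding disjoint_cover_def preimage_def by auto
qed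

lemma prenet_map_f': "prenet_map P T' f'"
proof -
  have cover:
    "preimage P f' (i - 1) (parents T' i x) = parents_of_set P i (preimage P f' i {x}) \<and>
      disjoint_cover P i (minimal_children P i (preimage P f' i {x}))
        (preimage P f' (i - 1) (parents T' i x)) \<and>
      disjoint_cover P i (maximal_children P i (preimage P f' i {x}))
        (preimage P f' (i - 1) (parents T' i x))"
    if i: "i \<in> {1, 2}" and x: "x \<in> verts T' i" for i x
  proof -
    note i0 = levels(1)[OF i] and i1 = levels(2)[OF i]
    define U where "U = preimage P f' i {x}"
    define W where "W = preimage S f (i - 1) (parents T i (g i x))"
    \<comment> \<open>Since \<open>g\<close> pulls back parents and the square commutes, both sides
      of the fibre conditions can be computed in \<open>S\<close> and pulled back along
      \<open>g'\<close>.\<close>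
    have "preimage P f' (i - 1) (parents T' i x) =
        {t \<in> V (i - 1). f' (i - 1) t \<in> verts T' (i - 1) \<and> g (i - 1) (f' (i - 1) t) \<in> parents T i (g i x)}"
      unfolding weak_equivalence_parents[OF T' T g(2) i x] by (auto simp: preimage_def)
    also have "\<dots> = preimage P g' (i - 1) W"
      using projections[OF i1] unfolding W_def preimage_def by auto
    finally have W: "preimage P f' (i - 1) (parents T' i x) = preimage P g' (i - 1) W" .
    have U: "U \<subseteq> V i" unfolding U_def preimage_def by auto
    \<comment> \<open>A vertex of \<open>P\<close> is determined by its two projections, and
      \<open>f'\<close> is constant on \<open>U\<close>.\<close>
    have inj: "inj_on (g' i) U"
      using V_eqI[OF i0] unfolding U_def preimage_def by (auto intro!: inj_onI)
    note covers = fibre_extremal_covers[OF i x, folded U_def W_def]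
    have "parents_of_set P i U = preimage P g' (i - 1) W"
      unfolding covers(1)[symmetric] by (auto simp: parents_of_set_def parents_P preimage_def)
    moreover have "minimal_children S i (g' i ` U) \<subseteq> g' i ` U"
      "maximal_children S i (g' i ` U) \<subseteq> g' i ` U"
      unfolding minimal_children_def maximal_children_def by auto
    ultimately show ?thesis
      using disjoint_cover_P[OF i U inj _ covers(2)] disjoint_cover_P[OF i U inj _ covers(3)]
        extremal_children_P[OF i U inj]
      unfolding W U_def[symmetric] by simp
  qed
  show ?thesis
    by (intro prenet_mapI cover) (use projections(2) circ_less_f' core_P in auto)
qed

end

section \<open>The section \<open>c\<close> and the assembly of the square\<close>

lemma weak_equivalence_section:
  assumes "prenet T'" "prenet T" and g: "weak_equivalence T' T g"
  shows "\<exists>c. (\<forall>i\<in>{0, 1, 2}. \<forall>y\<in>verts T i. c i y \<in> verts T' i \<and> g i (c i y) = y) \<and>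
    (\<forall>y\<in>core T. c 2 y \<in> core T')"
proof -
  have map: "prenet_map T' T g" and core: "g 2 ` core T' = core T"
    using g unfolding weak_equivalence_def bij_betw_def by auto
  \<comment> \<open>A core vertex gets its core preimage, any other vertex an arbitrary one. The
    membership tests stand inside the formula so that a witness exists for all \<open>i\<close> and
    \<open>y\<close> and choice yields a total \<open>c\<close>.\<close>
  have "\<exists>x. (i \<in> {0, 1, 2} \<and> y \<in> verts T i \<longrightarrow> x \<in> verts T' i \<and> g i x = y) \<and>
      (i = 2 \<and> y \<in> core T \<longrightarrow> x \<in> core T')" for i y
  proof (cases "i = 2 \<and> y \<in> core T")
    case True
    then have "y \<in> g 2 ` core T'" using core by simp
    then obtain x where "x \<in> core T'" "g 2 x = y" by blast
    then show ?thesis using True unfolding core_def by auto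
  next
    case False
    have "y \<in> g i ` verts T' i" if "i \<in> {0, 1, 2}" "y \<in> verts T i"
      using prenet_map_surj[OF assms(1,2) map that(1)] that(2) by simp
    then show ?thesis using False by blast
  qed
  then obtain c where "\<forall>i y. (i \<in> {0, 1, 2} \<and> y \<in> verts T i \<longrightarrow> c i y \<in> verts T' i \<and> g i (c i y) = y) \<and>
      (i = 2 \<and> y \<in> core T \<longrightarrow> c i y \<in> core T')"
    by metis
  then show ?thesis by blast
qed

theorem proposition3p12:
  fixes S :: "'a prenet_data" and T :: "'b prenet_data" and T' :: "'c prenet_data"
    and f :: "nat \<Rightarrow> 'a \<Rightarrow> 'b" and g :: "nat \<Rightarrow> 'c \<Rightarrow> 'b"
  assumes "prenet S" and "prenet T" and "prenet T'"
    and "prenet_map S T f"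
    and "weak_equivalence T' T g"
  shows "\<exists>(S' :: nat prenet_data) (f' :: nat \<Rightarrow> nat \<Rightarrow> 'c) (g' :: nat \<Rightarrow> nat \<Rightarrow> 'a).
           prenet S' \<and> prenet_map S' T' f' \<and> prenet_map S' S g' \<and>
           (\<forall>i\<in>{0, 1, 2}. \<forall>x\<in>verts S' i. g i (f' i x) = f i (g' i x)) \<and>
           weak_equivalence S' S g'"
proof -
  obtain c where c: "\<And>i y. i \<in> {0, 1, 2} \<Longrightarrow> y \<in> verts T i \<Longrightarrow> c i y \<in> verts T' i \<and> g i (c i y) = y"
      "\<And>y. y \<in> core T \<Longrightarrow> c 2 y \<in> core T'"
    using weak_equivalence_section[OF assms(3,2,5)] by blast
  define St where "St = staircase S T' f g c"
  have fin: "finite (St i)" if i: "i \<in> {0, 1, 2}" for i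
  proof (rule finite_subset)
    show "St i \<subseteq> verts S i \<times> verts T' i" unfolding St_def staircase_def by auto
    show "finite (verts S i \<times> verts T' i)"
      using finite_verts[OF prenet_two[OF assms(1)] i] finite_verts[OF prenet_two[OF assms(3)] i]
      by blast
  qed
  \<comment> \<open>Each finite level is numbered to obtain vertices in \<open>nat\<close>; the
    components of \<open>d i v\<close> become the two projections.\<close>
  have "\<exists>d :: nat \<Rightarrow> 'a \<times> 'c. bij_betw d {0..<card (St i)} (St i)" if "i \<in> {0, 1, 2}" for i
    using ex_bij_betw_nat_finite[OF fin[OF that]] .
  then obtain d :: "nat \<Rightarrow> nat \<Rightarrow> 'a \<times> 'c"
    where d: "\<And>i. i \<in> {0, 1, 2} \<Longrightarrow> bij_betw (d i) {0..<card (St i)} (St i)"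
    by metis
  interpret staircase_square S T T' f g c "\<lambda>i. {0..<card (St i)}"
    "\<lambda>i v. snd (d i v)" "\<lambda>i v. fst (d i v)"
    using assms c d by unfold_locales (auto simp: St_def)
  have "prenet_map P S (\<lambda>i v. fst (d i v))"
    using weak_equivalence_g' unfolding weak_equivalence_def by (rule conjunct1)
  then show ?thesis
    using prenet_P prenet_map_f' weak_equivalence_g' projections(3)
    by (intro exI[of _ P] exI[of _ "\<lambda>i v. snd (d i v)"] exI[of _ "\<lambda>i v. fst (d i v)"]) auto
qed

end
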